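(* Let $q$ be a prime power. For each $k\in\mathbb{F}_q$, let $C_k\subset\mathbb{P}^2$ be the plane-filling curve over $\mathbb{F}_q$ defined by $$x^2 (x^q y - x y^q) + y^2 (y^q z - y z^q) + (z^2 + k x^2)(z^q x - z x^q) = 0.$$ Then $C_k$ is smooth at every $\mathbb{F}_q$-point of $\mathbb{P}^2$ if and only if the polynomial $x^7 + kx^3 - 1\in\mathbb{F}_q[x]$ has no zeros in $\mathbb{F}_q$.
   Context: $\mathbb{P}^2$ is the projective plane with homogeneous coordinates $[x:y:z]$. A plane curve $C=\{f=0\}\subset\mathbb{P}^2$, with $f\in\mathbb{F}_q[x,y,z]$ nonzero homogeneous, is called plane-filling if it contains every $\mathbb{F}_q$-point of $\mathbb{P}^2$, i.e. $C(\mathbb{F}_q)=\mathbb{P}^2(\mathbb{F}_q)$. The curve $C$ is singular at a point $P$ if $f$ and all three partial derivatives $\partial f/\partial x,\partial f/\partial y,\partial f/\partial z$ vanish at $P$; it is smooth at a point $P\in C$ if it is not singular there. *)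

theory Defs
  imports Main "HOL-Library.Cardinality" "HOL-Computational_Algebra.Polynomial"
begin

text \<open>
  The ring \<open>F[x,y,z]\<close> is represented as \<open>F[x][y][z]\<close>: the outermost polynomial variable
  is \<open>z\<close>, the innermost is \<open>x\<close>. The field of \<open>q\<close> elements is a type \<open>'a :: {field, finite}\<close>
  with \<open>CARD('a) = q\<close>; that \<open>q\<close> is a prime power is automatic.
\<close>

type_synonym 'a poly3 = "'a poly poly poly"

definition var_x :: "'a::comm_ring_1 poly3" where "var_x = [:[:[:0, 1:]:]:]"
definition var_y :: "'a::comm_ring_1 poly3" where "var_y = [:[:0, 1:]:]"
definition var_z :: "'a::comm_ring_1 poly3" where "var_z = [:0, 1:]"

definition const3 :: "'a::comm_ring_1 \<Rightarrow> 'a poly3" where "const3 c = [:[:[:c:]:]:]"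

fun eval3 :: "'a::comm_ring_1 poly3 \<Rightarrow> 'a \<times> 'a \<times> 'a \<Rightarrow> 'a" where
  "eval3 f (a, b, c) = poly (poly (poly f [:[:c:]:]) [:b:]) a"

definition deriv_x :: "'a::idom poly3 \<Rightarrow> 'a poly3" where "deriv_x = map_poly (map_poly pderiv)"
definition deriv_y :: "'a::idom poly3 \<Rightarrow> 'a poly3" where "deriv_y = map_poly pderiv"
definition deriv_z :: "'a::idom poly3 \<Rightarrow> 'a poly3" where "deriv_z = pderiv"

definition homogeneous3 :: "nat \<Rightarrow> 'a::comm_ring_1 poly3 \<Rightarrow> bool" where
  "homogeneous3 d f \<longleftrightarrow>
     (\<forall>i j l. coeff (coeff (coeff f l) j) i \<noteq> 0 \<longrightarrow> i + j + l = d)"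

definition nonzero_vecs :: "('a::field \<times> 'a \<times> 'a) set" where
  "nonzero_vecs = UNIV - {(0, 0, 0)}"

definition proportional :: "(('a::field \<times> 'a \<times> 'a) \<times> ('a \<times> 'a \<times> 'a)) set" where
  "proportional = {((a, b, c), (a', b', c')) | a b c a' b' c'.
     (a, b, c) \<in> nonzero_vecs \<and> (\<exists>t. t \<noteq> 0 \<and> a' = t * a \<and> b' = t * b \<and> c' = t * c)}"

text \<open>A point \<open>[a:b:c]\<close> is the class of all its homogeneous coordinate vectors.\<close>

definition proj_plane :: "('a::field \<times> 'a \<times> 'a) set set" where
  "proj_plane = nonzero_vecs // proportional"

text \<open>
  For homogeneous \<open>f\<close>, vanishing at one coordinate vector of \<open>P\<close> and vanishing at all of
  them are the same.
\<close>

definition vanishes_at :: "'a::field poly3 \<Rightarrow> ('a \<times> 'a \<times> 'a) set \<Rightarrow> bool" where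
  "vanishes_at f P \<longleftrightarrow> (\<forall>v\<in>P. eval3 f v = 0)"

definition rational_points :: "'a::field poly3 \<Rightarrow> ('a \<times> 'a \<times> 'a) set set" where
  "rational_points f = {P \<in> proj_plane. vanishes_at f P}"

definition plane_filling :: "'a::field poly3 \<Rightarrow> bool" where
  "plane_filling f \<longleftrightarrow>
     f \<noteq> 0 \<and> (\<exists>d. homogeneous3 d f) \<and> rational_points f = proj_plane"

definition singular_at :: "'a::field poly3 \<Rightarrow> ('a \<times> 'a \<times> 'a) set \<Rightarrow> bool" where
  "singular_at f P \<longleftrightarrow>
     vanishes_at f P \<and> vanishes_at (deriv_x f) P \<and>
     vanishes_at (deriv_y f) P \<and> vanishes_at (deriv_z f) P"

definition smooth_at :: "'a::field poly3 \<Rightarrow> ('a \<times> 'a \<times> 'a) set \<Rightarrow> bool" where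
  "smooth_at f P \<longleftrightarrow> P \<in> rational_points f \<and> \<not> singular_at f P"

definition curve_poly :: "nat \<Rightarrow> 'a::field \<Rightarrow> 'a poly3" where
  "curve_poly q k =
     var_x^2 * (var_x^q * var_y - var_x * var_y^q)
     + var_y^2 * (var_y^q * var_z - var_y * var_z^q)
     + (var_z^2 + const3 k * var_x^2) * (var_z^q * var_x - var_z * var_x^q)"

end

theory Submission
  imports Defs
begin

text \<open>
  Let \<open>q\<close> be the number of elements of the field. Every scalar satisfies \<open>a\<^sup>q = a\<close>, so each of the
  three brackets \<open>x\<^sup>q y - x y\<^sup>q\<close>, \<open>y\<^sup>q z - y z\<^sup>q\<close>, \<open>z\<^sup>q x - z x\<^sup>q\<close> vanishes at every rational
  vector; this makes the curve plane-filling. Moreover \<open>q = 0\<close> in the field, so every derivation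
  kills \<open>q\<close>-th powers. By the Leibniz rule only the derivatives of the brackets contribute at a
  rational vector \<open>(a, b, c)\<close>, and in them the \<open>q\<close>-th powers behave as constants, so the gradient
  of the curve there is
  \<open>(c (c\<^sup>2 + k a\<^sup>2) - a\<^sup>2 b, a\<^sup>3 - b\<^sup>2 c, b\<^sup>3 - a (c\<^sup>2 + k a\<^sup>2))\<close>,
  independently of \<open>q\<close>. This is the lemma \<open>eval3_derivation_curve_poly\<close>.

  It remains to see when this gradient has a nontrivial zero (\<open>gradient_zero_root\<close>,
  \<open>root_gradient_zero\<close>). The equations force \<open>b \<noteq> 0\<close>, and \<open>a\<^sup>3 = b\<^sup>2 c\<close> then determines \<open>c\<close>: with
  \<open>t = a / b\<close>, a zero is proportional to \<open>(t, 1, t\<^sup>3)\<close>. For such a vector the third equation reads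
  \<open>t\<^sup>7 + k t\<^sup>3 = 1\<close>, and the first is \<open>t\<^sup>2\<close> times it. So the singular rational points are exactly the
  points \<open>[t : 1 : t\<^sup>3]\<close> with \<open>t\<close> a root of \<open>x\<^sup>7 + k x\<^sup>3 - 1\<close>.
\<close>

section \<open>Finite fields\<close>

text \<open>Translation by \<open>1\<close> permutes the field, so it does not change the sum of all elements.\<close>

lemma of_nat_CARD_eq_0: "of_nat CARD('a) = (0 :: 'a::{ring_1,finite})"
proof -
  have "(\<Sum>x\<in>UNIV. x) = (\<Sum>x\<in>UNIV. x + (1::'a))"
    by (rule sum.reindex_bij_witness[of _ "\<lambda>x. x + 1" "\<lambda>x. x - 1"]) auto
  then show ?thesis
    by (simp add: sum.distrib)
qed

text \<open>Multiplication by \<open>a\<close> permutes the nonzero elements, so it does not change their product.\<close>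

lemma power_CARD_eq_same:
  fixes a :: "'a::{field,finite}"
  shows "a ^ CARD('a) = a"
proof (cases "a = 0")
  case True
  then show ?thesis
    by simp
next
  case False
  let ?P = "\<Prod>x\<in>UNIV - {0::'a}. x"
  have "?P = (\<Prod>x\<in>UNIV - {0}. a * x)"
    by (rule prod.reindex_bij_witness[of _ "\<lambda>x. a * x" "\<lambda>x. x / a"]) (use False in auto)
  also have "\<dots> = a ^ (CARD('a) - 1) * ?P"
    by (simp add: prod.distrib)
  finally have "a ^ (CARD('a) - 1) = 1"
    by simp
  moreover have "a ^ CARD('a) = a * a ^ (CARD('a) - 1)"
    by (simp add: power_eq_if)
  ultimately show ?thesis
    by simp
qed

section \<open>Derivations of the polynomial ring\<close>

definition derivation :: "('b::comm_ring_1 \<Rightarrow> 'b) \<Rightarrow> bool" where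
  "derivation D \<longleftrightarrow> (\<forall>f g. D (f + g) = D f + D g) \<and> (\<forall>f g. D (f * g) = D f * g + f * D g)"

lemma derivation_add: "derivation D \<Longrightarrow> D (f + g) = D f + D g"
  and derivation_mult: "derivation D \<Longrightarrow> D (f * g) = D f * g + f * D g"
  by (simp_all add: derivation_def)

lemma derivation_0: "derivation D \<Longrightarrow> D 0 = 0"
  using derivation_add[of D 0 0] by simp

lemma derivation_1: "derivation D \<Longrightarrow> D 1 = 0"
  using derivation_mult[of D 1 1] by simp

lemma derivation_diff: "derivation D \<Longrightarrow> D (f - g) = D f - D g"
  using derivation_add[of D "f - g" g] by (simp add: algebra_simps)

lemma derivation_sum: "derivation D \<Longrightarrow> D (\<Sum>i\<in>I. f i) = (\<Sum>i\<in>I. D (f i))"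
  by (induction I rule: infinite_finite_induct) (simp_all add: derivation_0 derivation_add)

lemma derivation_power: "derivation D \<Longrightarrow> D (f ^ n) = of_nat n * f ^ (n - 1) * D f"
proof (induction n)
  case 0
  then show ?case
    by (simp add: derivation_1)
next
  case (Suc n)
  then show ?case
    by (cases n) (simp_all add: derivation_mult algebra_simps)
qed

lemma derivation_pderiv: "derivation (pderiv :: 'b::idom poly \<Rightarrow> 'b poly)"
  by (simp add: derivation_def pderiv_add pderiv_mult algebra_simps)

text \<open>
  Differentiating coefficientwise; this turns derivatives in the inner variables into
  derivations of the ring in all three variables.
\<close>

lemma derivation_map_poly:
  assumes "derivation D"
  shows "derivation (map_poly D)"
  unfolding derivation_def
  by (auto simp: poly_eq_iff coeff_map_poly coeff_mult derivation_0[OF assms]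
      derivation_add[OF assms] derivation_mult[OF assms] derivation_sum[OF assms] sum.distrib)

lemma derivation_deriv_x: "derivation (deriv_x :: 'a::idom poly3 \<Rightarrow> _)"
  and derivation_deriv_y: "derivation (deriv_y :: 'a::idom poly3 \<Rightarrow> _)"
  and derivation_deriv_z: "derivation (deriv_z :: 'a::idom poly3 \<Rightarrow> _)"
  by (simp_all add: deriv_x_def deriv_y_def deriv_z_def derivation_map_poly derivation_pderiv)

lemma deriv_vars [simp]:
  "deriv_x var_x = (1 :: 'a::idom poly3)" "deriv_x var_y = (0 :: 'a poly3)"
  "deriv_x var_z = (0 :: 'a poly3)" "deriv_x (const3 k) = (0 :: 'a poly3)"
  "deriv_y var_x = (0 :: 'a poly3)" "deriv_y var_y = (1 :: 'a poly3)"
  "deriv_y var_z = (0 :: 'a poly3)" "deriv_y (const3 k) = (0 :: 'a poly3)"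
  "deriv_z var_x = (0 :: 'a poly3)" "deriv_z var_y = (0 :: 'a poly3)"
  "deriv_z var_z = (1 :: 'a poly3)" "deriv_z (const3 k) = (0 :: 'a poly3)"
  by (simp_all add: deriv_x_def deriv_y_def deriv_z_def var_x_def var_y_def var_z_def const3_def
      map_poly_pCons pderiv_pCons one_pCons)

section \<open>Evaluation and homogeneity\<close>

lemma eval3_hom [simp]:
  "eval3 0 v = 0" "eval3 1 v = 1"
  "eval3 (f + g) v = eval3 f v + eval3 g v" "eval3 (f - g) v = eval3 f v - eval3 g v"
  "eval3 (f * g) v = eval3 f v * eval3 g v" "eval3 (f ^ n) v = eval3 f v ^ n"
  by (cases v; simp)+

lemma eval3_vars [simp]:
  "eval3 var_x (a, b, c) = a" "eval3 var_y (a, b, c) = b" "eval3 var_z (a, b, c) = c"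
  "eval3 (const3 k) v = k"
  by (cases v; simp add: var_x_def var_y_def var_z_def const3_def)+

declare eval3.simps [simp del]

lemma homogeneous3_add:
  "homogeneous3 d f \<Longrightarrow> homogeneous3 d g \<Longrightarrow> homogeneous3 d (f + g)"
  unfolding homogeneous3_def by (metis add_0 coeff_add)

lemma homogeneous3_diff:
  "homogeneous3 d f \<Longrightarrow> homogeneous3 d g \<Longrightarrow> homogeneous3 d (f - g)"
  unfolding homogeneous3_def by (metis diff_0_right coeff_diff)

text \<open>
  A nonzero coefficient of the product has a nonzero summand in its triple convolution, and the
  exponents in the two factors of that summand add up.
\<close>

lemma homogeneous3_mult:
  assumes "homogeneous3 d f" "homogeneous3 e g"
  shows "homogeneous3 (d + e) (f * g)"
  unfolding homogeneous3_def
proof (intro allI impI)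
  fix i j l
  assume "coeff (coeff (coeff (f * g) l) j) i \<noteq> 0"
  then have "(\<Sum>l'\<le>l. \<Sum>j'\<le>j. \<Sum>i'\<le>i. coeff (coeff (coeff f l') j') i' *
      coeff (coeff (coeff g (l - l')) (j - j')) (i - i')) \<noteq> 0"
    by (simp add: coeff_mult coeff_sum)
  then obtain l' j' i' where "l' \<le> l" "j' \<le> j" "i' \<le> i"
    and "coeff (coeff (coeff f l') j') i' \<noteq> 0"
    and "coeff (coeff (coeff g (l - l')) (j - j')) (i - i') \<noteq> 0"
    by (metis (no_types, lifting) atMost_iff mult_not_zero sum.not_neutral_contains_not_neutral)
  then have "l' \<le> l" "j' \<le> j" "i' \<le> i" "i' + j' + l' = d" "(i - i') + (j - j') + (l - l') = e"
    using assms unfolding homogeneous3_def by blast+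
  then show "i + j + l = d + e"
    by linarith
qed

lemma homogeneous3_const: "homogeneous3 0 (const3 k)"
  by (auto simp: homogeneous3_def const3_def coeff_pCons split: nat.splits)

lemma homogeneous3_power: "homogeneous3 d f \<Longrightarrow> homogeneous3 (n * d) (f ^ n)"
proof (induction n)
  case 0
  have "(1 :: 'a poly3) = const3 1"
    by (simp add: const3_def one_pCons)
  then show ?case
    using homogeneous3_const[of "1::'a"] by simp
next
  case (Suc n)
  then show ?case
    using homogeneous3_mult[of d f "n * d" "f ^ n"] by simp
qed

lemma homogeneous3_vars:
  "homogeneous3 1 var_x" "homogeneous3 1 var_y" "homogeneous3 1 var_z"
  by (auto simp: homogeneous3_def var_x_def var_y_def var_z_def coeff_pCons one_pCons
      split: nat.splits)

lemma homogeneous3_curve_poly: "homogeneous3 (q + 3) (curve_poly q k)"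
proof -
  have pow: "homogeneous3 n (v ^ n)" if "v \<in> {var_x, var_y, var_z}" for v :: "'a poly3" and n
    using that homogeneous3_vars homogeneous3_power[of 1 v n] by auto
  have bracket: "homogeneous3 (q + 1) (u ^ q * v - w * r ^ q)"
    if "{u, v, w, r} \<subseteq> {var_x, var_y, var_z}" for u v w r :: "'a poly3"
    using that pow[of u q] pow[of r q] pow[of v 1] pow[of w 1]
      homogeneous3_mult[of q "u ^ q" 1 v] homogeneous3_mult[of 1 w q "r ^ q"]
    by (intro homogeneous3_diff) simp_all
  have "homogeneous3 2 (const3 k * var_x\<^sup>2)"
    using homogeneous3_mult[OF homogeneous3_const[of k] pow[of var_x 2]] unfolding add_0 by simp
  then have front: "homogeneous3 2 (var_z\<^sup>2 + const3 k * var_x\<^sup>2)"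
    by (intro homogeneous3_add pow) simp_all
  have prod: "homogeneous3 (q + 3) (f * g)"
    if "homogeneous3 2 f" "homogeneous3 (q + 1) g" for f g :: "'a poly3"
  proof -
    have "2 + (q + 1) = q + 3"
      by simp
    then show ?thesis
      using homogeneous3_mult[OF that] by (simp only:)
  qed
  show ?thesis
    unfolding curve_poly_def
    by (intro homogeneous3_add prod front bracket pow) simp_all
qed

section \<open>The gradient at a rational vector\<close>

lemma eval3_curve_poly:
  fixes k :: "'a::{field,finite}"
  shows "eval3 (curve_poly CARD('a) k) v = 0"
  by (cases v) (simp add: curve_poly_def power_CARD_eq_same)

text \<open>
  Taking an arbitrary derivation that is trivial on scalars lets one computation give all three
  partial derivatives. The brackets evaluate to \<open>0\<close> and the \<open>q\<close>-th powers have derivative \<open>0\<close>,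
  which leaves the right-hand side after \<open>a\<^sup>q = a\<close>.
\<close>

lemma eval3_derivation_curve_poly:
  fixes k :: "'a::{field,finite}"
  assumes D: "derivation D" and const: "D (const3 k) = 0"
  shows "eval3 (D (curve_poly CARD('a) k)) (a, b, c) =
      (c * (c\<^sup>2 + k * a\<^sup>2) - a\<^sup>2 * b) * eval3 (D var_x) (a, b, c) +
      (a ^ 3 - b\<^sup>2 * c) * eval3 (D var_y) (a, b, c) +
      (b ^ 3 - a * (c\<^sup>2 + k * a\<^sup>2)) * eval3 (D var_z) (a, b, c)"
proof -
  have "of_nat CARD('a) = (0 :: 'a poly3)"
    by (simp add: of_nat_poly of_nat_CARD_eq_0)
  then have "D (f ^ CARD('a)) = 0" for f
    by (simp add: derivation_power[OF D])
  then show ?thesis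
    unfolding curve_poly_def power2_eq_square
    by (simp add: derivation_add[OF D] derivation_diff[OF D] derivation_mult[OF D] const
        power_CARD_eq_same) (simp add: algebra_simps power2_eq_square power3_eq_cube)
qed

lemma eval3_deriv_curve_poly:
  fixes k :: "'a::{field,finite}"
  shows "eval3 (deriv_x (curve_poly CARD('a) k)) (a, b, c) = c * (c\<^sup>2 + k * a\<^sup>2) - a\<^sup>2 * b"
    and "eval3 (deriv_y (curve_poly CARD('a) k)) (a, b, c) = a ^ 3 - b\<^sup>2 * c"
    and "eval3 (deriv_z (curve_poly CARD('a) k)) (a, b, c) = b ^ 3 - a * (c\<^sup>2 + k * a\<^sup>2)"
  by (simp_all add: eval3_derivation_curve_poly derivation_deriv_x derivation_deriv_y
      derivation_deriv_z)

text \<open>A polynomial whose gradient is nonzero somewhere is nonzero: here at \<open>(1, 0, 0)\<close>.\<close>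

lemma curve_poly_nonzero: "curve_poly CARD('a) (k :: 'a::{field,finite}) \<noteq> 0"
proof
  assume "curve_poly CARD('a) k = 0"
  then have "eval3 (deriv_y (curve_poly CARD('a) k)) (1, 0, 0) = 0"
    by (simp add: derivation_0 derivation_deriv_y)
  then show False
    by (simp add: eval3_deriv_curve_poly)
qed

lemma plane_filling_curve_poly: "plane_filling (curve_poly CARD('a) (k :: 'a::{field,finite}))"
  using curve_poly_nonzero homogeneous3_curve_poly
  by (auto simp: plane_filling_def rational_points_def vanishes_at_def eval3_curve_poly)

section \<open>Singular rational points\<close>

definition gradient_zero :: "'a::field \<Rightarrow> 'a \<times> 'a \<times> 'a \<Rightarrow> bool" where
  "gradient_zero k = (\<lambda>(a, b, c).
     a\<^sup>2 * b = c * (c\<^sup>2 + k * a\<^sup>2) \<and> a ^ 3 = b\<^sup>2 * c \<and> b ^ 3 = a * (c\<^sup>2 + k * a\<^sup>2))"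

lemma singular_at_curve_poly_iff:
  fixes k :: "'a::{field,finite}"
  shows "singular_at (curve_poly CARD('a) k) P \<longleftrightarrow> (\<forall>v\<in>P. gradient_zero k v)"
  by (auto simp: singular_at_def vanishes_at_def eval3_curve_poly eval3_deriv_curve_poly
      gradient_zero_def)

lemma gradient_zero_root:
  assumes "gradient_zero k (a, b, c)" "(a, b, c) \<noteq> (0, 0, 0)"
  shows "(a / b) ^ 7 + k * (a / b) ^ 3 = 1"
proof -
  have eqs: "a\<^sup>2 * b = c * (c\<^sup>2 + k * a\<^sup>2)" "a ^ 3 = b\<^sup>2 * c" "b ^ 3 = a * (c\<^sup>2 + k * a\<^sup>2)"
    using assms(1) by (simp_all add: gradient_zero_def)
  have "b \<noteq> 0"
  proof
    assume "b = 0"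
    with eqs(2) have "a = 0"
      by simp
    with \<open>b = 0\<close> eqs(1) have "c = 0"
      by simp
    with \<open>a = 0\<close> \<open>b = 0\<close> assms(2) show False
      by simp
  qed
  \<comment> \<open>The factor \<open>b\<^sup>4\<close> makes \<open>c\<close> occur only through \<open>b\<^sup>2 c = a\<^sup>3\<close>, which eliminates it.\<close>
  have "b ^ 7 = b ^ 4 * b ^ 3"
    by (simp flip: power_add)
  also have "\<dots> = a * (b\<^sup>2 * c)\<^sup>2 + k * a ^ 3 * b ^ 4"
    unfolding eqs(3) by (simp add: algebra_simps power_numeral_reduce)
  also have "\<dots> = a ^ 7 + k * a ^ 3 * b ^ 4"
    unfolding eqs(2)[symmetric] by (simp add: power_numeral_reduce)
  finally have *: "b ^ 7 = a ^ 7 + k * a ^ 3 * b ^ 4" .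
  have "(a / b) ^ 7 + k * (a / b) ^ 3 = (a ^ 7 + k * a ^ 3 * b ^ 4) / b ^ 7"
    using \<open>b \<noteq> 0\<close> by (simp add: field_simps power_numeral_reduce)
  also have "\<dots> = 1"
    unfolding *[symmetric] using \<open>b \<noteq> 0\<close> by simp
  finally show ?thesis .
qed

text \<open>The factor \<open>s\<close> runs through all coordinate vectors of the point \<open>[t : 1 : t\<^sup>3]\<close>.\<close>

lemma root_gradient_zero:
  assumes "t ^ 7 + k * t ^ 3 = 1"
  shows "gradient_zero k (s * t, s, s * t ^ 3)"
proof -
  have "t * ((t ^ 3)\<^sup>2 + k * t\<^sup>2) = 1"
    using assms by (simp add: algebra_simps power_numeral_reduce)
  then have "s ^ 3 = s ^ 3 * (t * ((t ^ 3)\<^sup>2 + k * t\<^sup>2))"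
    by simp
  also have "\<dots> = s * t * ((s * t ^ 3)\<^sup>2 + k * (s * t)\<^sup>2)"
    by (simp add: power_mult_distrib distrib_left power3_eq_cube power2_eq_square mult_ac)
  finally have key: "s ^ 3 = s * t * ((s * t ^ 3)\<^sup>2 + k * (s * t)\<^sup>2)" .
  have "s * t ^ 3 * ((s * t ^ 3)\<^sup>2 + k * (s * t)\<^sup>2) =
      t\<^sup>2 * (s * t * ((s * t ^ 3)\<^sup>2 + k * (s * t)\<^sup>2))"
    by (simp add: power2_eq_square power3_eq_cube mult_ac)
  also have "\<dots> = (s * t)\<^sup>2 * s"
    unfolding key[symmetric] by (simp add: power2_eq_square power3_eq_cube mult_ac)
  finally have "(s * t)\<^sup>2 * s = s * t ^ 3 * ((s * t ^ 3)\<^sup>2 + k * (s * t)\<^sup>2)"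
    by (rule sym)
  moreover have "(s * t) ^ 3 = s\<^sup>2 * (s * t ^ 3)"
    by (simp add: power2_eq_square power3_eq_cube mult_ac)
  ultimately show ?thesis
    using key unfolding gradient_zero_def by simp
qed

lemma proj_plane_obtain:
  assumes "P \<in> proj_plane"
  obtains a b c where "(a, b, c) \<in> P" "(a, b, c) \<noteq> (0, 0, 0)"
proof -
  from assms obtain a b c where v: "(a, b, c) \<in> nonzero_vecs" and P: "P = proportional `` {(a, b, c)}"
    unfolding proj_plane_def by (metis quotientE prod_cases3)
  have "((a, b, c), (a, b, c)) \<in> proportional"
    using v unfolding proportional_def by (auto intro!: exI[of _ 1])
  with v P show ?thesis
    by (intro that[of a b c]) (auto simp: nonzero_vecs_def)
qed

lemma singular_point_iff_root:
  fixes k :: "'a::{field,finite}"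
  shows "(\<exists>P\<in>proj_plane. singular_at (curve_poly CARD('a) k) P) \<longleftrightarrow>
    (\<exists>t. t ^ 7 + k * t ^ 3 = 1)"
proof
  assume "\<exists>P\<in>proj_plane. singular_at (curve_poly CARD('a) k) P"
  then show "\<exists>t. t ^ 7 + k * t ^ 3 = 1"
    by (metis proj_plane_obtain gradient_zero_root singular_at_curve_poly_iff)
next
  assume "\<exists>t. t ^ 7 + k * t ^ 3 = 1"
  then obtain t where t: "t ^ 7 + k * t ^ 3 = 1"
    by blast
  let ?P = "proportional `` {(t, 1, t ^ 3)}"
  have "?P \<in> proj_plane"
    by (simp add: proj_plane_def nonzero_vecs_def quotientI)
  moreover have "gradient_zero k v" if "v \<in> ?P" for v
    using that root_gradient_zero[OF t] by (auto simp: proportional_def)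
  ultimately show "\<exists>P\<in>proj_plane. singular_at (curve_poly CARD('a) k) P"
    unfolding singular_at_curve_poly_iff by blast
qed

theorem theorem1p2:
  fixes k :: "'a::{field,finite}" and q :: nat
  assumes "CARD('a) = q"
  shows "plane_filling (curve_poly q k) \<and>
    ((\<forall>P\<in>proj_plane. smooth_at (curve_poly q k) P) \<longleftrightarrow>
     \<not> (\<exists>t::'a. poly (monom 1 7 + monom k 3 - 1) t = 0))"
proof -
  have filling: "plane_filling (curve_poly q k)"
    unfolding assms[symmetric] by (rule plane_filling_curve_poly)
  then have "(\<forall>P\<in>proj_plane. smooth_at (curve_poly q k) P) \<longleftrightarrow>
      \<not> (\<exists>P\<in>proj_plane. singular_at (curve_poly q k) P)"
    by (auto simp: plane_filling_def smooth_at_def)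
  also have "\<dots> \<longleftrightarrow> \<not> (\<exists>t. t ^ 7 + k * t ^ 3 = 1)"
    unfolding assms[symmetric] by (simp only: singular_point_iff_root)
  also have "\<dots> \<longleftrightarrow> \<not> (\<exists>t::'a. poly (monom 1 7 + monom k 3 - 1) t = 0)"
    by (simp add: poly_monom)
  finally show ?thesis
    using filling by blast
qed

end
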